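(* Let $f:\mathbb{R}^n\to\mathbb{R}$ be an $L_s$-RSS and $C^1$ function, and suppose $f$ is bounded below on $C_s$. For any given $\gamma\in(0,\frac{1}{L_s}]$ and any HT-unstable stationary point $\mathbf{x}^*$ associated with $\gamma$, there exists a neighborhood $\mathcal{N}$ of $\mathbf{x}^*$ such that for any IHT sequence $(\mathbf{x}^k)_{k\ge0}$ associated with $\gamma$ starting from any $\mathbf{x}^0\in C_s$, there exists $N\in\mathbb{N}$ such that $\mathbf{x}^k\notin\mathcal{N}\cap C_s$ for all $k\ge N$.
   Context: Here $s,n$ are integers with $1\le s<n$, $\|\mathbf{x}\|_0$ is the number of nonzero entries of $\mathbf{x}$, and $C_s=\{\mathbf{x}\in\mathbb{R}^n\mid\|\mathbf{x}\|_0\le s\}$. RSS: a differentiable $f:\mathbb{R}^n\to\mathbb{R}$ is $L_s$-RSS (restricted strongly smooth with modulus $L_s>0$) if $f(\mathbf{y})\le f(\mathbf{x})+\langle\nabla f(\mathbf{x}),\mathbf{y}-\mathbf{x}\rangle+\frac{L_s}{2}\|\mathbf{y}-\mathbf{x}\|_2^2$ for all $\mathbf{x},\mathbf{y}\in C_s$. Hard thresholding operator: $H_s(\mathbf{x})=\arg\min_{\|\mathbf{z}\|_0\le s}\|\mathbf{z}-\mathbf{x}\|_2$, a set of minimizers that may contain more than one element. An IHT sequence associated with stepsize $\gamma$ starting from $\mathbf{x}^0\in C_s$ is any sequence with $\mathbf{x}^{k+1}\in H_s(\mathbf{x}^k-\gamma\nabla f(\mathbf{x}^k))$ for $k=0,1,\dots$.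 $\mathcal{I}^{\mathbf{x}}_s\subset\{1,\dots,n\}$ denotes a set of $s$ indices of the $s$ largest entries of $\mathbf{x}$ in absolute value; $\mathrm{supp}(\mathbf{x})$ is the set of indices of nonzero entries; $\nabla_{\mathcal{J}}f(\mathbf{x})$ is the restriction of $\nabla f(\mathbf{x})$ to the entries indexed by $\mathcal{J}$. For $\gamma>0$, a vector $\mathbf{x}^*\in C_s$ is a HT-unstable stationary point associated with $\gamma$ if $\nabla_{\mathrm{supp}(\mathbf{x}^* )}f(\mathbf{x}^* )=0$ but the inequality $$\min\big(|x^*_i|: i\in\mathcal{I}^{\mathbf{x}^*}_s\big)\ge\gamma\max\big(|\nabla_jf(\mathbf{x}^* )|: j\notin\mathrm{supp}(\mathbf{x}^* )\big)$$ fails (the left side does not depend on the choice of $\mathcal{I}^{\mathbf{x}^*}_s$). *)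

theory Defs
  imports "HOL-Analysis.Analysis"
begin

definition gradient :: "('a::real_inner \<Rightarrow> real) \<Rightarrow> 'a \<Rightarrow> 'a" where
  "gradient f x = (THE D. GDERIV f x :> D)"

lemma gradient_eqI:
  fixes f :: "'a::real_inner \<Rightarrow> real"
  assumes "GDERIV f x :> D"
  shows "gradient f x = D"
  unfolding gradient_def
proof (rule the_equality[where P = "\<lambda>D. GDERIV f x :> D", OF assms])
  fix D' assume "GDERIV f x :> D'"
  then have "(\<lambda>h. inner h D') = (\<lambda>h. inner h D)"
    using assms unfolding gderiv_def by (rule has_derivative_unique)
  then have "inner (D' - D) (D' - D) = 0"
    by (metis inner_diff_right right_minus_eq)
  then show "D' = D"
    by simp
qed

lemma GDERIV_gradient:
  fixes f :: "'a::euclidean_space \<Rightarrow> real"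
  assumes "f differentiable (at x)"
  shows "GDERIV f x :> gradient f x"
proof -
  obtain f' where f': "(f has_derivative f') (at x)"
    using assms unfolding differentiable_def by blast
  then have lin: "linear f'"
    by (rule has_derivative_linear)
  have "f' = (\<lambda>h. inner h (adjoint f' 1))"
    using adjoint_works[OF lin, of _ 1] by (auto simp: fun_eq_iff)
  with f' have "GDERIV f x :> adjoint f' 1"
    unfolding gderiv_def by simp
  then show ?thesis
    using gradient_eqI by metis
qed

definition C1 :: "('a::real_inner \<Rightarrow> real) \<Rightarrow> bool" where
  "C1 f \<longleftrightarrow> (\<forall>x. f differentiable (at x)) \<and> continuous_on UNIV (gradient f)"

definition supp :: "real ^ 'n \<Rightarrow> 'n set" where
  "supp x = {i. x $ i \<noteq> 0}"

definition l0_norm :: "real ^ 'n \<Rightarrow> nat" where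
  "l0_norm x = card (supp x)"

definition sparse_set :: "nat \<Rightarrow> (real ^ 'n) set" where
  "sparse_set s = {x. l0_norm x \<le> s}"

definition restricted_strongly_smooth :: "nat \<Rightarrow> real \<Rightarrow> (real ^ 'n \<Rightarrow> real) \<Rightarrow> bool" where
  "restricted_strongly_smooth s L f \<longleftrightarrow>
     L > 0 \<and> (\<forall>x. f differentiable (at x)) \<and>
     (\<forall>x \<in> sparse_set s. \<forall>y \<in> sparse_set s.
        f y \<le> f x + inner (gradient f x) (y - x) + L / 2 * (norm (y - x))\<^sup>2)"

definition hard_threshold :: "nat \<Rightarrow> real ^ 'n \<Rightarrow> (real ^ 'n) set" where
  "hard_threshold s x = {z. is_arg_min (\<lambda>z. norm (z - x)) (\<lambda>z. l0_norm z \<le> s) z}"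

definition IHT_sequence ::
    "nat \<Rightarrow> (real ^ 'n \<Rightarrow> real) \<Rightarrow> real \<Rightarrow> (nat \<Rightarrow> real ^ 'n) \<Rightarrow> bool" where
  "IHT_sequence s f \<gamma> X \<longleftrightarrow>
     X 0 \<in> sparse_set s \<and>
     (\<forall>k. X (Suc k) \<in> hard_threshold s (X k - \<gamma> *\<^sub>R gradient f (X k)))"

text \<open>All admissible choices of \<open>s\<close> indices of entries largest in absolute value.\<close>

definition top_index_sets :: "nat \<Rightarrow> real ^ 'n \<Rightarrow> 'n set set" where
  "top_index_sets s x = {I. card I = s \<and> (\<forall>i \<in> I. \<forall>j. j \<notin> I \<longrightarrow> \<bar>x $ j\<bar> \<le> \<bar>x $ i\<bar>)}"

lemma top_index_sets_nonempty:
  fixes x :: "real ^ 'n"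
  assumes "s \<le> CARD('n)"
  shows "top_index_sets s x \<noteq> {}"
  using assms
proof (induction s)
  case 0
  show ?case by (auto simp: top_index_sets_def intro!: exI[of _ "{}"])
next
  case (Suc s)
  then obtain I where I: "card I = s" "\<And>i j. i \<in> I \<Longrightarrow> j \<notin> I \<Longrightarrow> \<bar>x $ j\<bar> \<le> \<bar>x $ i\<bar>"
    by (auto simp: top_index_sets_def)
  have "I \<noteq> UNIV"
    using I(1) Suc.prems by (metis not_less_eq_eq order_refl)
  then have "- I \<noteq> {}" by blast
  then have "Max ((\<lambda>j. \<bar>x $ j\<bar>) ` (- I)) \<in> (\<lambda>j. \<bar>x $ j\<bar>) ` (- I)"
    by (intro Max_in) auto
  then obtain m where m: "m \<notin> I" "\<bar>x $ m\<bar> = Max ((\<lambda>j. \<bar>x $ j\<bar>) ` (- I))"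
    by auto
  have "\<bar>x $ j\<bar> \<le> \<bar>x $ m\<bar>" if "j \<notin> I" for j
    unfolding m(2) using that by (intro Max_ge) auto
  with I m(1) have "insert m I \<in> top_index_sets (Suc s) x"
    by (auto simp: top_index_sets_def)
  then show ?case by blast
qed

lemma Min_top_index_sets_unique:
  fixes x :: "real ^ 'n"
  assumes "0 < s" "I \<in> top_index_sets s x" "J \<in> top_index_sets s x"
  shows "Min ((\<lambda>i. \<bar>x $ i\<bar>) ` I) = Min ((\<lambda>i. \<bar>x $ i\<bar>) ` J)"
proof -
  have le: "Min ((\<lambda>i. \<bar>x $ i\<bar>) ` I) \<le> Min ((\<lambda>i. \<bar>x $ i\<bar>) ` J)"
    if I: "I \<in> top_index_sets s x" and J: "J \<in> top_index_sets s x" for I J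
  proof -
    have ne: "I \<noteq> {}" "J \<noteq> {}" and card: "card I = s" "card J = s"
      using I J \<open>0 < s\<close> by (auto simp: top_index_sets_def)
    have "Min ((\<lambda>i. \<bar>x $ i\<bar>) ` I) \<le> \<bar>x $ j\<bar>" if j: "j \<in> J" for j
    proof (cases "j \<in> I")
      case True
      then show ?thesis by (intro Min_le) auto
    next
      case False
      then have "\<not> I \<subseteq> J"
        using j card by (metis card_subset_eq finite)
      then obtain i where i: "i \<in> I" "i \<notin> J" by blast
      have "Min ((\<lambda>i. \<bar>x $ i\<bar>) ` I) \<le> \<bar>x $ i\<bar>"
        using i by (intro Min_le) auto
      also have "\<dots> \<le> \<bar>x $ j\<bar>"
        using J i(2) j by (auto simp: top_index_sets_def)
      finally show ?thesis .
    qed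
    then show ?thesis
      using ne by (intro Min.boundedI) auto
  qed
  show ?thesis
    using le assms by (intro antisym) auto
qed

text \<open>For \<open>0 < s < n\<close> the extrema below range over nonempty finite sets. By the two preceding
  lemmas, quantifying existentially over the choice of \<open>I\<close> is the same as quantifying
  universally.\<close>

definition HT_unstable_stationary ::
    "nat \<Rightarrow> (real ^ 'n \<Rightarrow> real) \<Rightarrow> real \<Rightarrow> real ^ 'n \<Rightarrow> bool" where
  "HT_unstable_stationary s f \<gamma> x \<longleftrightarrow>
     \<gamma> > 0 \<and> x \<in> sparse_set s \<and>
     (\<forall>i \<in> supp x. gradient f x $ i = 0) \<and>
     (\<exists>I \<in> top_index_sets s x.
        \<not> Min ((\<lambda>i. \<bar>x $ i\<bar>) ` I) \<ge> \<gamma> * Max ((\<lambda>j. \<bar>gradient f x $ j\<bar>) ` (- supp x)))"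

end

theory Submission
  imports Defs
begin

text \<open>
  An IHT step minimises over \<open>sparse_set s\<close> the quadratic model
  \<open>m x z = \<langle>\<nabla>f x, z - x\<rangle> + \<parallel>z - x\<parallel>\<^sup>2 / (2 \<gamma>)\<close> of \<open>z \<mapsto> f z - f x\<close>, because completing the
  square turns \<open>m x z\<close> into a positive multiple of \<open>\<parallel>z - (x - \<gamma> \<nabla>f x)\<parallel>\<^sup>2\<close> plus a term free of
  \<open>z\<close>. As \<open>\<gamma> \<le> 1 / L\<close>, restricted smoothness makes \<open>f x + m x z\<close> an upper bound of \<open>f z\<close>. Hence
  an IHT step from \<open>x\<close> changes \<open>f\<close> by at most \<open>m x z\<close> for \<^emph>\<open>every\<close> sparse competitor \<open>z\<close>
  (lemma \<open>hard_threshold_descent\<close>).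

  The choice \<open>z = x\<close> shows that \<open>f\<close> never increases along an IHT sequence; being bounded below,
  its values converge, and the decrease per step tends to zero. On the other hand, instability
  of \<open>xs\<close> provides a sparse \<open>z\<close> with \<open>m xs z < 0\<close> (lemma \<open>HT_unstable_swap\<close>): drop a smallest of
  the \<open>s\<close> leading entries in favour of a gradient step in a coordinate off the support.
  This \<open>z\<close> is kept fixed while \<open>x\<close> varies: continuity of \<open>\<nabla>f\<close> gives a neighbourhood of \<open>xs\<close>
  on which \<open>m x z\<close> stays below a fixed negative number. Each visit to that neighbourhood
  costs a fixed amount of \<open>f\<close>, so there are only finitely many visits.

  For \<open>\<gamma> = 1 / L\<close> the descent estimate does not bound the distance between successive iterates,
  which is why the argument compares values of \<open>f\<close> only.
\<close>

definition quadratic_model :: "('a::real_inner \<Rightarrow> real) \<Rightarrow> real \<Rightarrow> 'a \<Rightarrow> 'a \<Rightarrow> real" where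
  "quadratic_model f \<gamma> x z = inner (gradient f x) (z - x) + (norm (z - x))\<^sup>2 / (2 * \<gamma>)"

lemma quadratic_model_self [simp]: "quadratic_model f \<gamma> x x = 0"
  by (simp add: quadratic_model_def)

lemma quadratic_model_complete_square:
  assumes "0 < \<gamma>"
  shows "quadratic_model f \<gamma> x z =
    ((norm (z - (x - \<gamma> *\<^sub>R gradient f x)))\<^sup>2 - (norm (\<gamma> *\<^sub>R gradient f x))\<^sup>2) / (2 * \<gamma>)"
proof -
  have "z - (x - \<gamma> *\<^sub>R gradient f x) = (z - x) + \<gamma> *\<^sub>R gradient f x"
    by simp
  then have "(norm (z - (x - \<gamma> *\<^sub>R gradient f x)))\<^sup>2 =
      (norm (z - x))\<^sup>2 + 2 * \<gamma> * inner (gradient f x) (z - x) + (norm (\<gamma> *\<^sub>R gradient f x))\<^sup>2"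
    by (simp only: power2_norm_eq_inner inner_add_left inner_add_right inner_scaleR_left
        inner_scaleR_right inner_commute[of "z - x" "gradient f x"] distrib_left)
  with assms show ?thesis
    by (simp add: quadratic_model_def field_simps)
qed

lemma hard_threshold_minimises_quadratic_model:
  assumes "0 < \<gamma>"
    and y: "y \<in> hard_threshold s (x - \<gamma> *\<^sub>R gradient f x)"
    and z: "z \<in> sparse_set s"
  shows "quadratic_model f \<gamma> x y \<le> quadratic_model f \<gamma> x z"
proof -
  have "norm (y - (x - \<gamma> *\<^sub>R gradient f x)) \<le> norm (z - (x - \<gamma> *\<^sub>R gradient f x))"
    using y z by (force simp: hard_threshold_def is_arg_min_def sparse_set_def)
  then have "(norm (y - (x - \<gamma> *\<^sub>R gradient f x)))\<^sup>2 \<le> (norm (z - (x - \<gamma> *\<^sub>R gradient f x)))\<^sup>2"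
    by (intro power_mono) auto
  with assms(1) show ?thesis
    by (simp add: quadratic_model_complete_square divide_right_mono)
qed

lemma hard_threshold_sparse: "y \<in> hard_threshold s x \<Longrightarrow> y \<in> sparse_set s"
  by (simp add: hard_threshold_def is_arg_min_def sparse_set_def)

lemma restricted_strongly_smooth_le_quadratic_model:
  assumes "restricted_strongly_smooth s L f" "0 < \<gamma>" "\<gamma> \<le> 1 / L"
    and "x \<in> sparse_set s" "y \<in> sparse_set s"
  shows "f y \<le> f x + quadratic_model f \<gamma> x y"
proof -
  have "0 < L"
    using assms(1) by (simp add: restricted_strongly_smooth_def)
  then have "L / 2 \<le> 1 / (2 * \<gamma>)"
    using assms(2,3) by (simp add: field_simps)
  then have "L / 2 * (norm (y - x))\<^sup>2 \<le> 1 / (2 * \<gamma>) * (norm (y - x))\<^sup>2"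
    by (intro mult_right_mono) auto
  moreover have "f y \<le> f x + inner (gradient f x) (y - x) + L / 2 * (norm (y - x))\<^sup>2"
    using assms(1,4,5) by (simp add: restricted_strongly_smooth_def)
  ultimately show ?thesis
    by (simp add: quadratic_model_def)
qed

text \<open>The competitor \<open>z\<close> is arbitrary, so a single \<open>z\<close> can serve for all \<open>x\<close> near a given
  point, whereas \<open>y\<close> may jump between different supports.\<close>

lemma hard_threshold_descent:
  assumes "restricted_strongly_smooth s L f" "0 < \<gamma>" "\<gamma> \<le> 1 / L"
    and "x \<in> sparse_set s" "z \<in> sparse_set s"
    and "y \<in> hard_threshold s (x - \<gamma> *\<^sub>R gradient f x)"
  shows "f y \<le> f x + quadratic_model f \<gamma> x z"
  using restricted_strongly_smooth_le_quadratic_model[OF assms(1-4)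
      hard_threshold_sparse[OF assms(6)]]
    hard_threshold_minimises_quadratic_model[OF assms(2,6,5)]
  by linarith

lemma IHT_sequence_sparse:
  assumes "IHT_sequence s f \<gamma> X"
  shows "X k \<in> sparse_set s"
  using assms by (cases k) (auto simp: IHT_sequence_def intro: hard_threshold_sparse)

text \<open>Failure of the stability inequality yields \<open>i\<close> among the \<open>s\<close> leading indices and \<open>j\<close> off the
  support with \<open>\<bar>x $ i\<bar> < \<gamma> \<bar>\<nabla>f x $ j\<bar>\<close>. Deleting entry \<open>i\<close> and setting entry \<open>j\<close> to
  \<open>- \<gamma> \<nabla>f x $ j\<close> changes the model by \<open>((x $ i)\<^sup>2 - (\<gamma> \<nabla>f x $ j)\<^sup>2) / (2 \<gamma>)\<close>, since the
  gradient vanishes on the support.\<close>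

lemma HT_unstable_swap:
  fixes x :: "real ^ 'n"
  assumes "1 \<le> s" "s < CARD('n)" "HT_unstable_stationary s f \<gamma> x"
  obtains z where "z \<in> sparse_set s" "quadratic_model f \<gamma> x z < 0"
proof -
  define g where "g = gradient f x"
  obtain I where \<gamma>: "0 < \<gamma>" and sparse: "card (supp x) \<le> s"
    and stat: "\<And>i. x $ i \<noteq> 0 \<Longrightarrow> g $ i = 0"
    and I: "card I = s" "\<And>i j. i \<in> I \<Longrightarrow> j \<notin> I \<Longrightarrow> \<bar>x $ j\<bar> \<le> \<bar>x $ i\<bar>"
    and lt: "Min ((\<lambda>i. \<bar>x $ i\<bar>) ` I) < \<gamma> * Max ((\<lambda>j. \<bar>g $ j\<bar>) ` (- supp x))"
    using assms(3)
    by (auto simp: HT_unstable_stationary_def top_index_sets_def sparse_set_def l0_norm_def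
        supp_def g_def not_le)
  have "I \<noteq> {}"
    using I(1) assms(1) by auto
  then have "Min ((\<lambda>i. \<bar>x $ i\<bar>) ` I) \<in> (\<lambda>i. \<bar>x $ i\<bar>) ` I"
    by (intro Min_in) auto
  then obtain i where i: "i \<in> I" "Min ((\<lambda>i. \<bar>x $ i\<bar>) ` I) = \<bar>x $ i\<bar>"
    by auto
  have "supp x \<noteq> UNIV"
    using sparse assms(2) by auto
  then have "- supp x \<noteq> {}"
    by blast
  then have "Max ((\<lambda>j. \<bar>g $ j\<bar>) ` (- supp x)) \<in> (\<lambda>j. \<bar>g $ j\<bar>) ` (- supp x)"
    by (intro Max_in) auto
  then obtain j where j: "j \<notin> supp x" "Max ((\<lambda>j. \<bar>g $ j\<bar>) ` (- supp x)) = \<bar>g $ j\<bar>"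
    by auto
  have ij: "\<bar>x $ i\<bar> < \<bar>\<gamma> * g $ j\<bar>"
    using lt \<gamma> by (simp add: i(2) j(2) abs_mult)
  have xj: "x $ j = 0"
    using j(1) by (simp add: supp_def)
  define d where "d = - axis i (x $ i) - axis j (\<gamma> * g $ j)"
  \<comment> \<open>The indices \<open>i\<close> and \<open>j\<close> may coincide, but then \<open>x $ i = 0\<close> and the first summand of \<open>d\<close>
    vanishes; so the formulas below need no case distinction.\<close>
  have "supp (x + d) \<subseteq> insert j (supp x - {i})"
    using xj by (auto simp: supp_def d_def axis_def split: if_splits)
  moreover have "card (supp x - {i}) < s"
  proof (cases "x $ i = 0")
    case True
    \<comment> \<open>A vanishing leading entry leaves no nonzero entries outside the leading ones.\<close>
    then have "supp x \<subseteq> I"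
      using I(2)[OF i(1)] by (auto simp: supp_def)
    then have "supp x - {i} \<subset> I"
      using i(1) by auto
    then show ?thesis
      using psubset_card_mono[of I] I(1) by auto
  next
    case False
    then show ?thesis
      using card_Diff1_less[of "supp x" i] sparse by (simp add: supp_def)
  qed
  ultimately have "card (supp (x + d)) \<le> s"
    using card_mono[of "insert j (supp x - {i})" "supp (x + d)"]
    by (auto simp: card_insert_if split: if_splits)
  then have "x + d \<in> sparse_set s"
    by (simp add: sparse_set_def l0_norm_def)
  moreover have "quadratic_model f \<gamma> x (x + d) < 0"
  proof -
    have "inner g d = - (\<gamma> * (g $ j)\<^sup>2)"
      using stat[of i] by (auto simp: d_def inner_diff_right inner_axis power2_eq_square)
    moreover have "(norm d)\<^sup>2 = (x $ i)\<^sup>2 + (\<gamma> * g $ j)\<^sup>2"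
      unfolding power2_norm_eq_inner d_def using xj
      by (auto simp: inner_diff_right inner_diff_left inner_axis_axis power2_eq_square)
    ultimately have "quadratic_model f \<gamma> x (x + d) = ((x $ i)\<^sup>2 - (\<gamma> * g $ j)\<^sup>2) / (2 * \<gamma>)"
      using \<gamma> by (simp add: quadratic_model_def g_def[symmetric] field_simps power2_eq_square)
    moreover have "(x $ i)\<^sup>2 < (\<gamma> * g $ j)\<^sup>2"
      using ij abs_le_square_iff[of "\<gamma> * g $ j" "x $ i"] by linarith
    ultimately show ?thesis
      using \<gamma> by (simp add: divide_neg_pos)
  qed
  ultimately show thesis
    using that by blast
qed

text \<open>Such a sequence converges, so a decrease by a fixed amount can occur only finitely
  often.\<close>

lemma decseq_bdd_below_eventually_small_decrease:
  fixes a :: "nat \<Rightarrow> real"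
  assumes "decseq a" "bdd_below (range a)" "0 < \<delta>"
  shows "\<forall>\<^sub>F k in sequentially. a k < a (Suc k) + \<delta>"
proof -
  obtain l where "a \<longlonglongrightarrow> l"
    using LIMSEQ_decseq_INF[OF assms(2,1)] by blast
  then have "(\<lambda>k. a k - a (Suc k)) \<longlonglongrightarrow> l - l"
    by (intro tendsto_diff LIMSEQ_Suc)
  then have "\<forall>\<^sub>F k in sequentially. a k - a (Suc k) < \<delta>"
    using assms(3) by (intro order_tendstoD(2)[where y = "l - l"]) auto
  then show ?thesis
    by (simp add: algebra_simps)
qed

theorem corollary6:
  fixes f :: "real ^ 'n \<Rightarrow> real" and s :: nat and L \<gamma> :: real and xs :: "real ^ 'n"
  assumes "1 \<le> s" and "s < CARD('n)"
    and "restricted_strongly_smooth s L f"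
    and "C1 f"
    and "bdd_below (f ` sparse_set s)"
    and "0 < \<gamma>" and "\<gamma> \<le> 1 / L"
    and "HT_unstable_stationary s f \<gamma> xs"
  shows "\<exists>U. open U \<and> xs \<in> U \<and>
           (\<forall>X. IHT_sequence s f \<gamma> X \<longrightarrow> (\<exists>N. \<forall>k\<ge>N. X k \<notin> U \<inter> sparse_set s))"
proof -
  obtain z where z: "z \<in> sparse_set s" "quadratic_model f \<gamma> xs z < 0"
    using HT_unstable_swap assms(1,2,8) by blast
  define \<delta> where "\<delta> = - quadratic_model f \<gamma> xs z / 2"
  have \<delta>: "0 < \<delta>"
    using z(2) by (simp add: \<delta>_def)
  define U where "U = {x. quadratic_model f \<gamma> x z < - \<delta>}"
  have "continuous_on UNIV (gradient f)"
    using assms(4) by (simp add: C1_def)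
  then have "continuous_on UNIV (\<lambda>x. quadratic_model f \<gamma> x z)"
    unfolding quadratic_model_def using assms(6) by (intro continuous_intros) auto
  then have "open U"
    unfolding U_def by (intro open_Collect_less continuous_on_const)
  moreover have "xs \<in> U"
    using z(2) by (simp add: U_def \<delta>_def)
  moreover have "\<exists>N. \<forall>k\<ge>N. X k \<notin> U \<inter> sparse_set s" if X: "IHT_sequence s f \<gamma> X" for X
  proof -
    have descent: "f (X (Suc k)) \<le> f (X k) + quadratic_model f \<gamma> (X k) y"
      if "y \<in> sparse_set s" for k y
      using hard_threshold_descent[OF assms(3,6,7) IHT_sequence_sparse[OF X] that] X
      by (simp add: IHT_sequence_def)
    have "f (X (Suc k)) \<le> f (X k)" for k
      using descent[OF IHT_sequence_sparse[OF X], of k k] by simp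
    then have "decseq (\<lambda>k. f (X k))"
      by (rule decseq_SucI)
    moreover have "bdd_below (range (\<lambda>k. f (X k)))"
      using IHT_sequence_sparse[OF X] by (intro bdd_below_mono[OF assms(5)]) auto
    ultimately obtain N where N: "\<And>k. N \<le> k \<Longrightarrow> f (X k) < f (X (Suc k)) + \<delta>"
      using decseq_bdd_below_eventually_small_decrease[OF _ _ \<delta>]
      unfolding eventually_sequentially by blast
    have "X k \<notin> U" if "N \<le> k" for k
      using N[OF that] descent[OF z(1), of k] by (simp add: U_def)
    then show ?thesis
      by blast
  qed
  ultimately show ?thesis
    by blast
qed

end
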